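(* Let $\sigma=\tilde\cup_i\sigma_i\subset\mathbb{R}^2$ be a self-distancing set with a finite or countable ordered family of closed connected components $\sigma_1,\sigma_2,\ldots$. If there exists a steepest descent curve extending $\sigma$ (i.e. $\Gamma_\sigma\ne\emptyset$), then for every $i\ge1$ such that the component $\sigma_{i+1}$ exists and is not reduced to a point (so that it is a steepest descent curve $\gamma_{i+1}$, with first point $x_{i+1}^-$), $$\bigcup_{j=1}^i\sigma_j\subset\mathfrak{H}(\gamma_{i+1},x_{i+1}^-).$$
   Context: A self-distancing set is a bounded set $\sigma\subset\mathbb{R}^2$ linearly ordered by $\preceq$ such that $x_1\preceq x_2\preceq x_3$ in $\sigma$ implies $|x_2-x_1|\le|x_3-x_1|$. A steepest descent curve (SDC) is a closed connected self-distancing set not reduced to a point (such a set is known to be a rectifiable curve oriented by $\preceq$). $\Gamma_\sigma$ is the family of SDC $\gamma\supset\sigma$ whose order extends that of $\sigma$. The notation $\sigma=\tilde\cup_i\sigma_i$ means that $\sigma$ is a self-distancing set whose closed connected components form a finite or countable family ordered as the points of $\sigma$: $i<j$, $x\in\sigma_i$, $y\in\sigma_j$ imply $x\preceq y$. For an SDC $\gamma$ with absolutely continuous (e.g. arc-length) parametrization $t\mapsto x(t)$ and $x_1\in\gamma$, $\mathfrak{H}(\gamma,x_1)=\bigcap_{x_1\preceq x(t)}\{y\in\mathbb{R}^2:\langle\dot x(t),y-x(t)\rangle\le0\}$, the intersection being over the $t$ at which $\dot x(t)$ is defined. *)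

theory Defs
  imports "HOL-Analysis.Analysis"
begin

definition self_distancing :: "(real^2) set \<Rightarrow> (real^2) rel \<Rightarrow> bool" where
  "self_distancing \<sigma> r \<longleftrightarrow>
     bounded \<sigma> \<and> linear_order_on \<sigma> r \<and>
     (\<forall>x1\<in>\<sigma>. \<forall>x2\<in>\<sigma>. \<forall>x3\<in>\<sigma>. (x1, x2) \<in> r \<longrightarrow> (x2, x3) \<in> r \<longrightarrow>
        norm (x2 - x1) \<le> norm (x3 - x1))"

text \<open>The empty set, which is connected in the library, is also excluded by the last conjunct.\<close>

definition steepest_descent_curve :: "(real^2) set \<Rightarrow> (real^2) rel \<Rightarrow> bool" where
  "steepest_descent_curve \<gamma> r \<longleftrightarrow>
     closed \<gamma> \<and> connected \<gamma> \<and> self_distancing \<gamma> r \<and> \<not> (\<exists>p. \<gamma> \<subseteq> {p})"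

definition SDC_extensions :: "(real^2) set \<Rightarrow> (real^2) rel \<Rightarrow> ((real^2) set \<times> (real^2) rel) set" where
  "SDC_extensions \<sigma> r =
     {(\<gamma>, r'). steepest_descent_curve \<gamma> r' \<and> \<sigma> \<subseteq> \<gamma> \<and> Restr r' \<sigma> = r}"

text \<open>\<open>I\<close> is the index set of the family: an initial segment of the positive integers,
  or all of them. Connected components are closed in \<open>\<sigma>\<close> automatically; here they are
  required to be closed in the plane.\<close>

definition ordered_component_union ::
  "(real^2) set \<Rightarrow> (real^2) rel \<Rightarrow> nat set \<Rightarrow> (nat \<Rightarrow> (real^2) set) \<Rightarrow> bool" where
  "ordered_component_union \<sigma> r I s \<longleftrightarrow>
     self_distancing \<sigma> r \<and>
     (I = {1..} \<or> (\<exists>n. I = {1..n})) \<and>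
     bij_betw s I (components \<sigma>) \<and>
     (\<forall>i\<in>I. closed (s i)) \<and>
     (\<forall>i\<in>I. \<forall>j\<in>I. i < j \<longrightarrow> (\<forall>x\<in>s i. \<forall>y\<in>s j. (x, y) \<in> r))"

definition first_point :: "(real^2) set \<Rightarrow> (real^2) rel \<Rightarrow> real^2" where
  "first_point \<gamma> r = (THE x. x \<in> \<gamma> \<and> (\<forall>y\<in>\<gamma>. (x, y) \<in> r))"

text \<open>Absolute continuity in the classical sense, with finite families \<open>]u k, v k[\<close>, \<open>k < n\<close>,
  of pairwise disjoint open subintervals.\<close>

definition absolutely_continuous_path :: "real \<Rightarrow> real \<Rightarrow> (real \<Rightarrow> real^2) \<Rightarrow> bool" where
  "absolutely_continuous_path a b x \<longleftrightarrow>
     (\<forall>\<epsilon>>0. \<exists>\<delta>>0. \<forall>(n::nat) (u :: nat \<Rightarrow> real) (v :: nat \<Rightarrow> real).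
        (\<forall>k<n. a \<le> u k \<and> u k \<le> v k \<and> v k \<le> b) \<longrightarrow>
        disjoint_family_on (\<lambda>k. {u k<..<v k}) {..<n} \<longrightarrow>
        (\<Sum>k<n. v k - u k) < \<delta> \<longrightarrow>
        (\<Sum>k<n. norm (x (v k) - x (u k))) < \<epsilon>)"

text \<open>A parametrization follows the order of the curve; it may be constant on subintervals.\<close>

definition AC_parametrization ::
  "(real^2) set \<Rightarrow> (real^2) rel \<Rightarrow> real \<Rightarrow> real \<Rightarrow> (real \<Rightarrow> real^2) \<Rightarrow> bool" where
  "AC_parametrization \<gamma> r a b x \<longleftrightarrow>
     a < b \<and> absolutely_continuous_path a b x \<and> x ` {a..b} = \<gamma> \<and>
     (\<forall>t\<in>{a..b}. \<forall>t'\<in>{a..b}. t \<le> t' \<longrightarrow> (x t, x t') \<in> r)"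

text \<open>The set \<open>\<HH>(\<gamma>, x1)\<close>, for the curve \<open>\<gamma>\<close> with order \<open>r\<close> parametrized by
  \<open>x\<close> on \<open>[a, b]\<close>. At the endpoints the derivative is the one-sided one.\<close>

definition frak_H :: "(real^2) rel \<Rightarrow> real \<Rightarrow> real \<Rightarrow> (real \<Rightarrow> real^2) \<Rightarrow> real^2 \<Rightarrow> (real^2) set" where
  "frak_H r a b x x1 =
     (\<Inter>t \<in> {t \<in> {a..b}. (x1, x t) \<in> r \<and> x differentiable (at t within {a..b})}.
        {y. vector_derivative x (at t within {a..b}) \<bullet> (y - x t) \<le> 0})"

text \<open>The description of \<^const>\<open>first_point\<close> is proper on a steepest descent curve.\<close>

lemma first_point_unique_exists:
  assumes "steepest_descent_curve \<gamma> r"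
  shows "\<exists>!x. x \<in> \<gamma> \<and> (\<forall>y\<in>\<gamma>. (x, y) \<in> r)"
proof -
  have lin: "linear_order_on \<gamma> r" and bd: "bounded \<gamma>" and cl: "closed \<gamma>"
    and ne: "\<gamma> \<noteq> {}"
    and sd: "\<And>x1 x2 x3. (x1, x2) \<in> r \<Longrightarrow> (x2, x3) \<in> r \<Longrightarrow> norm (x2 - x1) \<le> norm (x3 - x1)"
    using assms
    by (auto simp: steepest_descent_curve_def self_distancing_def order_on_defs subset_iff)
  have tot: "(x, y) \<in> r \<or> (y, x) \<in> r" if "x \<in> \<gamma>" "y \<in> \<gamma>" for x y
    using lin that by (cases "x = y") (auto simp: order_on_defs total_on_def refl_on_def)
  have anti: "x = y" if "(x, y) \<in> r" "(y, x) \<in> r" for x y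
    using lin that by (auto simp: order_on_defs antisym_def)
  have tr: "(x, z) \<in> r" if "(x, y) \<in> r" "(y, z) \<in> r" for x y z
    using lin that by (meson order_on_defs(1,2,3) transD)
  define down where "down y = {z. (z, y) \<in> r}" for y
  define F where "F = (\<lambda>y. closure (down y)) ` \<gamma>"
  have "compact \<gamma>" using cl bd by (simp add: compact_eq_bounded_closed)
  have "\<gamma> \<inter> \<Inter>F \<noteq> {}"
  proof (rule compact_imp_fip[OF \<open>compact \<gamma>\<close>])
    show "closed T" if "T \<in> F" for T using that by (auto simp: F_def)
    fix F' assume F': "finite F'" "F' \<subseteq> F"
    then obtain B where B: "B \<subseteq> \<gamma>" "finite B" "F' = (\<lambda>y. closure (down y)) ` B"
      unfolding F_def by (meson finite_subset_image)
    have "\<exists>m\<in>\<gamma>. \<forall>y\<in>B. (m, y) \<in> r"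
      using B(2,1)
    proof (induction B rule: finite_induct)
      case empty
      then show ?case using ne by auto
    next
      case (insert z B)
      then obtain m where m: "m \<in> \<gamma>" "\<forall>y\<in>B. (m, y) \<in> r" by auto
      have "z \<in> \<gamma>" using insert.prems by simp
      consider "(m, z) \<in> r" | "(z, m) \<in> r" using tot m(1) \<open>z \<in> \<gamma>\<close> by blast
      then show ?case
      proof cases
        case 1
        then show ?thesis using m by blast
      next
        case 2
        have "(z, z) \<in> r" using tot \<open>z \<in> \<gamma>\<close> by blast
        then show ?thesis using 2 m tr \<open>z \<in> \<gamma>\<close> by blast
      qed
    qed
    then obtain m where m: "m \<in> \<gamma>" "\<forall>y\<in>B. (m, y) \<in> r" by blast
    have "m \<in> closure (down y)" if "y \<in> B" for y
      by (rule closure_subset[THEN subsetD]) (use m that in \<open>simp add: down_def\<close>)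
    with m B show "\<gamma> \<inter> \<Inter>F' \<noteq> {}" by blast
  qed
  then obtain x where x: "x \<in> \<gamma>" "\<And>y. y \<in> \<gamma> \<Longrightarrow> x \<in> closure (down y)"
    by (auto simp: F_def)
  have min: "(x, y) \<in> r" if y: "y \<in> \<gamma>" for y
  proof (rule ccontr)
    assume n: "(x, y) \<notin> r"
    then have yx: "(y, x) \<in> r" using tot x y by blast
    then have "x \<noteq> y" using n by auto
    then have "0 < norm (y - x) / 2" by simp
    then obtain z where z: "(z, y) \<in> r" "dist z x < norm (y - x) / 2"
      using x(2)[OF y] unfolding closure_approachable down_def by blast
    have "norm (y - z) \<le> norm (x - z)" using sd z yx by blast
    moreover have "norm (y - x) \<le> norm (y - z) + norm (z - x)"
      by (metis diff_add_cancel norm_triangle_ineq add_diff_eq)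
    ultimately show False using z(2) by (simp add: dist_norm norm_minus_commute)
  qed
  show ?thesis using x(1) min anti by blast
qed

lemma component_steepest_descent_curve:
  assumes "ordered_component_union \<sigma> r I s" "i \<in> I" "\<not> (\<exists>p. s i = {p})"
  shows "steepest_descent_curve (s i) (Restr r (s i))"
proof -
  have comp: "s i \<in> components \<sigma>" and sd: "self_distancing \<sigma> r" and cl: "closed (s i)"
    using assms by (auto simp: ordered_component_union_def bij_betw_def)
  have sub: "s i \<subseteq> \<sigma>" and ne: "s i \<noteq> {}" and con: "connected (s i)"
    using comp in_components_subset in_components_nonempty in_components_connected by blast+
  have "linear_order_on (s i) (Restr r (s i))"
  proof -
    have r: "refl_on \<sigma> r" "trans r" "antisym r" "total_on \<sigma> r"
      using sd by (auto simp: self_distancing_def order_on_defs)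
    have "refl_on (s i) (Restr r (s i))" using r(1) sub by (auto simp: refl_on_def)
    moreover have "trans (Restr r (s i))" using r(2) by (rule trans_Restr)
    moreover have "antisym (Restr r (s i))" using r(3) by (rule antisym_Restr)
    moreover have "total_on (s i) (Restr r (s i))"
      using total_on_subset[OF r(4) sub] by (simp add: total_on_def)
    ultimately show ?thesis by (simp add: order_on_defs)
  qed
  moreover have "bounded (s i)"
    using sd sub bounded_subset by (auto simp: self_distancing_def)
  moreover have "norm (x2 - x1) \<le> norm (x3 - x1)"
    if "(x1, x2) \<in> r" "(x2, x3) \<in> r" "x1 \<in> s i" "x2 \<in> s i" "x3 \<in> s i" for x1 x2 x3
    using sd that subsetD[OF sub] unfolding self_distancing_def by simp
  ultimately have "self_distancing (s i) (Restr r (s i))"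
    unfolding self_distancing_def by simp
  then show ?thesis
    using cl con ne assms(3) unfolding steepest_descent_curve_def by (metis subset_singletonD)
qed

end

theory Submission
  imports Defs
begin

text \<open>If \<open>y\<close> precedes a curve in a self-distancing set, then \<open>y \<preceq> x t \<preceq> x t'\<close> for \<open>t \<le> t'\<close>,
  so the distance from \<open>y\<close> to \<open>x t\<close> does not decrease as \<open>t\<close> grows. The derivative of half
  its square is \<open>vector_derivative x \<bullet> (x t - y)\<close>, which is therefore nonnegative wherever it
  exists: this is the half-plane condition at \<open>x t\<close>. A point of an earlier component precedes
  all points of a later one, so the argument applies to all earlier components.\<close>

lemma mono_on_imp_derivative_within_nonneg:
  fixes f :: "real \<Rightarrow> real"
  assumes "mono_on S f" and "t \<in> S" and "t islimpt S"
    and deriv: "(f has_real_derivative D) (at t within S)"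
  shows "D \<ge> 0"
proof (rule tendsto_lowerbound)
  show "((\<lambda>u. (f u - f t) / (u - t)) \<longlongrightarrow> D) (at t within S)"
    using deriv by (simp add: has_field_derivative_iff)
  show "\<forall>\<^sub>F u in at t within S. 0 \<le> (f u - f t) / (u - t)"
    unfolding eventually_at_filter
  proof (intro always_eventually allI impI)
    fix u assume "u \<in> S"
    then show "0 \<le> (f u - f t) / (u - t)"
      using mono_onD[OF \<open>mono_on S f\<close>, of u t] mono_onD[OF \<open>mono_on S f\<close>, of t u] \<open>t \<in> S\<close>
      by (cases "u \<le> t") (auto simp: divide_nonpos_nonpos)
  qed
  show "at t within S \<noteq> bot"
    using \<open>t islimpt S\<close> by (simp add: trivial_limit_within)
qed

text \<open>The squared distance is used because, unlike the distance, it is differentiable even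
  where the curve passes through \<open>y\<close>.\<close>

lemma receding_imp_derivative_inner_nonpos:
  fixes x :: "real \<Rightarrow> 'a::real_inner"
  assumes recede: "\<And>u v. u \<in> S \<Longrightarrow> v \<in> S \<Longrightarrow> u \<le> v \<Longrightarrow> norm (x u - y) \<le> norm (x v - y)"
    and "t \<in> S" and "t islimpt S"
    and deriv: "(x has_vector_derivative d) (at t within S)"
  shows "d \<bullet> (y - x t) \<le> 0"
proof -
  have "((\<lambda>u. (x u - y) \<bullet> (x u - y)) has_derivative
      (\<lambda>h. (x t - y) \<bullet> (h *\<^sub>R d) + (h *\<^sub>R d) \<bullet> (x t - y))) (at t within S)"
    using deriv unfolding has_vector_derivative_def
    by (auto intro!: derivative_eq_intros)
  then have "((\<lambda>u. (x u - y) \<bullet> (x u - y)) has_real_derivative 2 * (d \<bullet> (x t - y))) (at t within S)"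
    unfolding has_field_derivative_def
    by (rule has_derivative_eq_rhs) (simp add: fun_eq_iff inner_commute algebra_simps)
  moreover have "mono_on S (\<lambda>u. (x u - y) \<bullet> (x u - y))"
    using recede by (auto intro!: mono_onI power_mono simp: dot_square_norm)
  ultimately have "0 \<le> 2 * (d \<bullet> (x t - y))"
    using mono_on_imp_derivative_within_nonneg assms(2,3) by blast
  then show ?thesis
    by (simp add: inner_diff_right)
qed

lemma predecessor_in_frak_H:
  assumes sd: "self_distancing \<sigma> r" and "\<gamma> \<subseteq> \<sigma>" and "y \<in> \<sigma>"
    and before: "\<And>z. z \<in> \<gamma> \<Longrightarrow> (y, z) \<in> r"
    and par: "AC_parametrization \<gamma> (Restr r \<gamma>) a b x"
  shows "y \<in> frak_H (Restr r \<gamma>) a b x x1"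
proof -
  have "a < b" and img: "x ` {a..b} = \<gamma>"
    and ord: "\<And>u v. u \<in> {a..b} \<Longrightarrow> v \<in> {a..b} \<Longrightarrow> u \<le> v \<Longrightarrow> (x u, x v) \<in> r"
    using par by (auto simp: AC_parametrization_def)
  have recede: "norm (x u - y) \<le> norm (x v - y)"
    if uv: "u \<in> {a..b}" "v \<in> {a..b}" "u \<le> v" for u v
  proof -
    have "x u \<in> \<gamma>" "x v \<in> \<gamma>"
      using uv img by auto
    then show ?thesis
      using sd before ord[OF uv] \<open>\<gamma> \<subseteq> \<sigma>\<close> \<open>y \<in> \<sigma>\<close> unfolding self_distancing_def by blast
  qed
  have "vector_derivative x (at t within {a..b}) \<bullet> (y - x t) \<le> 0"
    if "t \<in> {a..b}" "x differentiable (at t within {a..b})" for t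
  proof (rule receding_imp_derivative_inner_nonpos[where S = "{a..b}"])
    show "t islimpt {a..b}"
      using \<open>a < b\<close> \<open>t \<in> {a..b}\<close> by (simp add: islimpt_Icc)
  qed (use recede that in \<open>auto simp: vector_derivative_works\<close>)
  then show ?thesis
    by (auto simp: frak_H_def)
qed

theorem lemma5p6:
  fixes \<sigma> :: "(real^2) set" and r :: "(real^2) rel"
    and I :: "nat set" and s :: "nat \<Rightarrow> (real^2) set"
    and i :: nat and a b :: real and x :: "real \<Rightarrow> real^2"
  assumes "ordered_component_union \<sigma> r I s"
    and "SDC_extensions \<sigma> r \<noteq> {}"
    and "i \<ge> 1" and "i + 1 \<in> I"
    and "\<not> (\<exists>p. s (i + 1) = {p})"
    and "AC_parametrization (s (i + 1)) (Restr r (s (i + 1))) a b x"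
  shows "(\<Union>j\<in>{1..i}. s j) \<subseteq>
    frak_H (Restr r (s (i + 1))) a b x (first_point (s (i + 1)) (Restr r (s (i + 1))))"
proof
  fix y assume "y \<in> (\<Union>j\<in>{1..i}. s j)"
  then obtain j where j: "1 \<le> j" "j < i + 1" "y \<in> s j"
    by auto
  have sd: "self_distancing \<sigma> r" and bij: "bij_betw s I (components \<sigma>)"
    and ord: "\<And>k l z w. k \<in> I \<Longrightarrow> l \<in> I \<Longrightarrow> k < l \<Longrightarrow> z \<in> s k \<Longrightarrow> w \<in> s l \<Longrightarrow> (z, w) \<in> r"
    using assms(1) unfolding ordered_component_union_def by blast+
  have "j \<in> I"
    using assms(1,4) j by (auto simp: ordered_component_union_def)
  have sub: "s k \<subseteq> \<sigma>" if "k \<in> I" for k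
    using bij that bij_betwE in_components_subset by blast
  show "y \<in> frak_H (Restr r (s (i + 1))) a b x (first_point (s (i + 1)) (Restr r (s (i + 1))))"
  proof (rule predecessor_in_frak_H[OF sd sub[OF assms(4)]])
    show "y \<in> \<sigma>"
      using sub \<open>j \<in> I\<close> j(3) by blast
    show "(y, z) \<in> r" if "z \<in> s (i + 1)" for z
      using ord[OF \<open>j \<in> I\<close> assms(4) j(2,3) that] .
  qed (fact assms(6))
qed

end
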